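(* Let $N\ge 1$ be an integer and consider the caching problem with $N$ files and $K=N$ users, each equipped with a cache of the same (normalized) size $M$. Then the cache-rate pair $(M,R)=(1/N,\,N-1)$ is achievable. Furthermore, for every real $M\in[0,1/N]$, the cache-rate pair $(M,\,N(1-M))$ is achievable; that is, with cache size $M$ a peak delivery rate of at most $N(1-M)$ is achievable.
   Context: Caching problem with $N$ files and $K$ users. A server holds $N$ independent files $W_1,\dots,W_N$, each uniformly distributed on $\{0,1\}^F$ ($F$ bits per file). All $K$ users are connected to the server through one shared error-free link, so that every user receives everything the server transmits. Each user has a cache. The system works in two phases. Placement phase (before demands are known): user $k$ stores in its cache $Z_k=\varphi_k(W_1,\dots,W_N)$, where $\varphi_k$ is an arbitrary function. Delivery phase: each user $k$ requests one full file $W_{d_k}$; the demand vector $d=(d_1,\dots,d_K)\in\{1,\dots,N\}^K$ is arbitrary and known to the server and all users. The server broadcasts $X_d=\psi_d(W_1,\dots,W_N)$, and user $k$ forms an estimate $\hat W_{d,k}=\mu_{d,k}(X_d,Z_k)$ of $W_{d_k}$. The functions $\varphi_k,\psi_d,\mu_{d,k}$ form a caching scheme for file size $F$; its error probability is $\max_{d}\max_{k}\Pr(\hat W_{d,k}\neq W_{d_k})$. Cache sizes and rates are normalized by the file size. A cache-rate pair $(M,R)$ with $M,R\ge 0$ is called achievable if for every $\varepsilon>0$ and all sufficiently large $F$ there is a caching scheme for file size $F$ in which each $Z_k$ takes at most $2^{(M+\varepsilon)F}$ values, each $X_d$ (for every demand $d$) takes at most $2^{(R+\varepsilon)F}$ values,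 and the error probability is less than $\varepsilon$. The rate $R$ is thus a peak (worst-case over demands) rate. *)

theory Defs
  imports "HOL-Probability.Probability" "HOL-Probability.Product_PMF"
begin

definition bit_strings :: "nat \<Rightarrow> bool list set" where
  "bit_strings F = {w. length w = F}"

(* A file tuple (W_1, ..., W_N) is a function on {1..N}, extended by [] outside {1..N}. *)
definition files_pmf :: "nat \<Rightarrow> nat \<Rightarrow> (nat \<Rightarrow> bool list) pmf" where
  "files_pmf N F = Pi_pmf {1..N} [] (\<lambda>_. pmf_of_set (bit_strings F))"

definition demands :: "nat \<Rightarrow> nat \<Rightarrow> (nat \<Rightarrow> nat) set" where
  "demands N K = {1..K} \<rightarrow>\<^sub>E {1..N}"

(* Cache contents and broadcast messages are labelled by bit strings of arbitrary, possibly
   varying, length. Only the number of labels that occur is constrained below, so this is no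
   restriction: the values of a function of the N files always form a finite set. *)
record caching_scheme =
  placement :: "nat \<Rightarrow> (nat \<Rightarrow> bool list) \<Rightarrow> bool list"
  delivery  :: "(nat \<Rightarrow> nat) \<Rightarrow> (nat \<Rightarrow> bool list) \<Rightarrow> bool list"
  decoder   :: "(nat \<Rightarrow> nat) \<Rightarrow> nat \<Rightarrow> bool list \<Rightarrow> bool list \<Rightarrow> bool list"

definition estimate ::
  "caching_scheme \<Rightarrow> (nat \<Rightarrow> nat) \<Rightarrow> nat \<Rightarrow> (nat \<Rightarrow> bool list) \<Rightarrow> bool list" where
  "estimate S d k W = decoder S d k (delivery S d W) (placement S k W)"

(* The maximum ranges over a finite set, which is nonempty whenever N, K \<ge> 1. *)
definition error_probability :: "nat \<Rightarrow> nat \<Rightarrow> nat \<Rightarrow> caching_scheme \<Rightarrow> real" where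
  "error_probability N K F S =
     Max ((\<lambda>(d, k). measure_pmf.prob (files_pmf N F) {W. estimate S d k W \<noteq> W (d k)})
          ` (demands N K \<times> {1..K}))"

definition achievable :: "nat \<Rightarrow> nat \<Rightarrow> real \<Rightarrow> real \<Rightarrow> bool" where
  "achievable N K M R \<longleftrightarrow> M \<ge> 0 \<and> R \<ge> 0 \<and>
     (\<forall>\<epsilon>>0. \<forall>\<^sub>F F in sequentially. \<exists>S.
        (\<forall>k\<in>{1..K}. real (card (placement S k ` set_pmf (files_pmf N F)))
                       \<le> 2 powr ((M + \<epsilon>) * real F)) \<and>
        (\<forall>d\<in>demands N K. real (card (delivery S d ` set_pmf (files_pmf N F)))
                       \<le> 2 powr ((R + \<epsilon>) * real F)) \<and>
        error_probability N K F S < \<epsilon>)"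

end

(* If some file is not requested, sending the at most N - 1 requested files is cheap enough.
   Otherwise the users request pairwise distinct files. Reserve disjoint blocks of m = floor (M F)
   bit positions, one block per user; user k caches, at each position of block k, the parity of the
   bits of all N files. The server sends all bits except those of the file d(k) in block k,
   for every k. At a position of block k user k therefore receives the bits of all the other
   files and recovers the bit of its own file from the cached parity; outside block k all
   bits of its file are sent. The message has N F - N m bits. *)
theory Submission
  imports Defs
begin

section \<open>Bit strings and decoding without error\<close>

lemma finite_bit_strings: "finite (bit_strings F)"
  and card_bit_strings: "card (bit_strings F) = 2 ^ F"
  using finite_lists_length_eq[of "UNIV :: bool set" F] card_lists_length_eq[of "UNIV :: bool set" F]
  by (simp_all add: bit_strings_def)

lemma length_file:
  assumes "W \<in> set_pmf (files_pmf N F)" and "n \<in> {1..N}"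
  shows "length (W n) = F"
proof -
  have "bit_strings F \<noteq> {}"
    using card_bit_strings[of F] by auto
  then show ?thesis
    using assms finite_bit_strings[of F]
    by (auto simp: files_pmf_def set_Pi_pmf PiE_dflt_def bit_strings_def)
qed

lemma card_image_bit_strings_le:
  fixes f :: "'a \<Rightarrow> bool list"
  assumes "\<And>W. W \<in> A \<Longrightarrow> length (f W) = L"
  shows "card (f ` A) \<le> 2 ^ L"
  using card_mono[OF finite_bit_strings, of "f ` A" L] assms
  by (auto simp: card_bit_strings) (auto simp: bit_strings_def)

text \<open>The decoder picks any file tuple consistent with the message and the cache and reads off
  the requested file; since all consistent tuples agree on that file, every choice is right. This
  reduces correctness of a scheme to comparing two file tuples.\<close>

lemma zero_error_scheme:
  fixes Z :: "nat \<Rightarrow> (nat \<Rightarrow> bool list) \<Rightarrow> bool list"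
    and X :: "(nat \<Rightarrow> nat) \<Rightarrow> (nat \<Rightarrow> bool list) \<Rightarrow> bool list"
  assumes "N \<ge> 1" and "K \<ge> 1"
    and determined: "\<And>d k W W'. \<lbrakk>d \<in> demands N K; k \<in> {1..K};
      W \<in> set_pmf (files_pmf N F); W' \<in> set_pmf (files_pmf N F);
      X d W = X d W'; Z k W = Z k W'\<rbrakk> \<Longrightarrow> W (d k) = W' (d k)"
  shows "\<exists>S. placement S = Z \<and> delivery S = X \<and> error_probability N K F S = 0"
proof -
  let ?A = "set_pmf (files_pmf N F)"
  define dec where
    "dec d k x z = (SOME W. W \<in> ?A \<and> X d W = x \<and> Z k W = z) (d k)" for d :: "nat \<Rightarrow> nat" and k x z
  define S where "S = \<lparr>placement = Z, delivery = X, decoder = dec\<rparr>"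
  have correct: "estimate S d k W = W (d k)"
    if "d \<in> demands N K" "k \<in> {1..K}" "W \<in> ?A" for d k W
  proof -
    let ?P = "\<lambda>V. V \<in> ?A \<and> X d V = X d W \<and> Z k V = Z k W"
    have "?P (SOME V. ?P V)"
      by (rule someI[of ?P W]) (use that in auto)
    then show ?thesis
      using determined[OF that(1,2) _ that(3), of "SOME V. ?P V"]
      by (simp add: estimate_def S_def dec_def)
  qed
  have "measure_pmf.prob (files_pmf N F) {W. estimate S d k W \<noteq> W (d k)} = 0"
    if "d \<in> demands N K" "k \<in> {1..K}" for d k
    using correct[OF that] by (auto simp: measure_pmf_zero_iff)
  \<comment> \<open>Nonemptiness makes the image exactly \<open>{0}\<close>, so that its
    \<open>Max\<close> is 0.\<close>
  moreover have "demands N K \<times> {1..K} \<noteq> {}"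
    using assms(1,2) by (auto simp: demands_def PiE_eq_empty_iff)
  ultimately have "(\<lambda>(d, k). measure_pmf.prob (files_pmf N F) {W. estimate S d k W \<noteq> W (d k)})
      ` (demands N K \<times> {1..K}) = {0}"
    by (auto simp: image_iff)
  then have "error_probability N K F S = 0"
    by (simp add: error_probability_def)
  then show ?thesis
    by (intro exI[of _ S]) (simp add: S_def)
qed

section \<open>Blocks of positions and the transmitted bits\<close>

definition user_block :: "nat \<Rightarrow> nat \<Rightarrow> nat set" where
  "user_block m k = {(k - 1) * m..<k * m}"

lemma card_user_block: "k \<ge> 1 \<Longrightarrow> card (user_block m k) = m"
  by (simp add: user_block_def algebra_simps)

text \<open>For \<open>a < b\<close>, block \<open>a\<close> ends at \<open>a * m\<close>, which is
  at most the start \<open>(b - 1) * m\<close> of block \<open>b\<close>. Index 0 gives an empty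
  block, as the subtraction is truncated.\<close>

lemma user_block_inj:
  assumes "p \<in> user_block m j" "p \<in> user_block m k"
  shows "j = k"
proof (rule ccontr)
  have *: False if "a < b" "p \<in> user_block m a" "p \<in> user_block m b" for a b
  proof -
    have "a * m \<le> (b - 1) * m"
      using that(1) by (intro mult_right_mono) auto
    moreover have "p < a * m" "(b - 1) * m \<le> p"
      using that(2,3) by (simp_all add: user_block_def)
    ultimately show False
      by linarith
  qed
  assume "j \<noteq> k"
  then show False
    using *[of j k] *[of k j] assms by linarith
qed

definition withheld :: "nat \<Rightarrow> nat \<Rightarrow> (nat \<Rightarrow> nat) \<Rightarrow> (nat \<times> nat) set" where
  "withheld N m d = (\<lambda>(k, p). (d k, p)) ` (SIGMA k:{1..N}. user_block m k)"

text \<open>A pair \<open>(n, p)\<close> stands for bit \<open>p\<close> of file \<open>n\<close>.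
  With as many users as files, injectivity of a demand vector means that every file is requested.
  The set depends on the demands but not on the file contents, so users know which bits they
  receive.\<close>

definition sent_bits :: "nat \<Rightarrow> nat \<Rightarrow> nat \<Rightarrow> (nat \<Rightarrow> nat) \<Rightarrow> (nat \<times> nat) set" where
  "sent_bits N F m d =
     (if inj_on d {1..N} then {1..N} \<times> {..<F} - withheld N m d else d ` {1..N} \<times> {..<F})"

lemma finite_sent_bits: "finite (sent_bits N F m d)"
  by (simp add: sent_bits_def)

lemma card_withheld:
  assumes "inj_on d {1..N}"
  shows "card (withheld N m d) = N * m"
proof -
  have "inj_on (\<lambda>(k, p). (d k, p)) (SIGMA k:{1..N}. user_block m k)"
    by (intro inj_onI) (auto dest: inj_onD[OF assms])
  then have "card (withheld N m d) = card (SIGMA k:{1..N}. user_block m k)"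
    by (simp add: withheld_def card_image)
  also have "\<dots> = (\<Sum>k\<in>{1..N}. card (user_block m k))"
    by (simp add: user_block_def)
  also have "\<dots> = N * m"
    by (simp add: card_user_block)
  finally show ?thesis .
qed

lemma card_sent_bits_le:
  assumes "d \<in> demands N N" and "N * m \<le> F"
  shows "card (sent_bits N F m d) \<le> N * F - N * m"
proof (cases "inj_on d {1..N}")
  case True
  \<comment> \<open>The last block ends at \<open>N * m \<le> F\<close>, so all blocks fit into one
    file.\<close>
  have "p < F" if "k \<in> {1..N}" "p \<in> user_block m k" for k p
  proof -
    have "k * m \<le> N * m"
      using that(1) by (intro mult_right_mono) auto
    moreover have "p < k * m"
      using that(2) by (simp add: user_block_def)
    ultimately show ?thesis
      using assms(2) by linarith
  qed
  then have "withheld N m d \<subseteq> {1..N} \<times> {..<F}"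
    using assms(1) by (auto simp: withheld_def demands_def PiE_iff)
  then have "card ({1..N} \<times> {..<F} - withheld N m d) = N * F - N * m"
    using True finite_subset[of "withheld N m d" "{1..N} \<times> {..<F}"]
    by (simp add: card_Diff_subset card_withheld card_cartesian_product)
  then show ?thesis
    using True by (simp add: sent_bits_def)
next
  case False
  have "card (d ` {1..N}) \<noteq> N"
    using False eq_card_imp_inj_on[of "{1..N}" d] by auto
  moreover have "card (d ` {1..N}) \<le> N"
    using card_image_le[of "{1..N}" d] by simp
  ultimately have "card (d ` {1..N}) * F \<le> (N - 1) * F"
    by (intro mult_right_mono) auto
  \<comment> \<open>Leaving out one whole file saves \<open>F\<close> bits, at least the
    \<open>N * m\<close> saved in the other case.\<close>
  also have "\<dots> \<le> N * F - N * m"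
    using assms(2) by (simp add: algebra_simps)
  finally show ?thesis
    using False by (simp add: sent_bits_def card_cartesian_product)
qed

section \<open>Parities and decodability\<close>

definition bit_parity :: "nat \<Rightarrow> (nat \<Rightarrow> bool list) \<Rightarrow> nat \<Rightarrow> bool" where
  "bit_parity N W p \<longleftrightarrow> odd (\<Sum>n\<in>{1..N}. of_bool (W n ! p) :: nat)"

text \<open>Splitting the summand of file \<open>n\<close> off both sums leaves equal remainders, so
  equal parities force the two split-off bits to agree.\<close>

lemma bit_eq_if_parity_eq:
  assumes "n \<in> {1..N}" and "bit_parity N W p = bit_parity N W' p"
    and "\<And>j. j \<in> {1..N} - {n} \<Longrightarrow> W j ! p = W' j ! p"
  shows "W n ! p = W' n ! p"
proof -
  have "(\<Sum>j\<in>{1..N} - {n}. of_bool (W j ! p) :: nat) = (\<Sum>j\<in>{1..N} - {n}. of_bool (W' j ! p))"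
    using assms(3) by (intro sum.cong) auto
  moreover have "(\<Sum>j\<in>{1..N}. of_bool (V j ! p) :: nat) =
      of_bool (V n ! p) + (\<Sum>j\<in>{1..N} - {n}. of_bool (V j ! p))" for V :: "nat \<Rightarrow> bool list"
    using assms(1) by (intro sum.remove) auto
  ultimately show ?thesis
    using assms(2) unfolding bit_parity_def by (auto split: if_splits)
qed

lemma bits_decodable:
  assumes d: "d \<in> demands N N" and k: "k \<in> {1..N}" and p: "p < F"
    and sent: "\<And>n p. (n, p) \<in> sent_bits N F m d \<Longrightarrow> W n ! p = W' n ! p"
    and cached: "\<And>p. p \<in> user_block m k \<Longrightarrow> bit_parity N W p = bit_parity N W' p"
  shows "W (d k) ! p = W' (d k) ! p"
proof -
  have dk: "d k \<in> {1..N}"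
    using d k by (auto simp: demands_def PiE_iff)
  show ?thesis
  proof (cases "inj_on d {1..N} \<and> p \<in> user_block m k")
    case True
    \<comment> \<open>By disjointness of the blocks, \<open>p\<close> belongs to user
      \<open>k\<close> alone, so the only bit withheld at \<open>p\<close> is that of file
      \<open>d k\<close>.\<close>
    have "(n, p) \<in> sent_bits N F m d" if "n \<in> {1..N} - {d k}" for n
      using that True p user_block_inj[of p m _ k] by (auto simp: sent_bits_def withheld_def)
    then show ?thesis
      using True by (intro bit_eq_if_parity_eq[where W = W and W' = W', OF dk cached sent]) blast+
  next
    case False
    have "(d k, p) \<in> sent_bits N F m d"
    proof (cases "inj_on d {1..N}")
      case True
      \<comment> \<open>A user \<open>j\<close> responsible for withholding this bit would satisfy
        \<open>d j = d k\<close>, hence \<open>j = k\<close>, but \<open>p\<close> lies outside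
        block \<open>k\<close>.\<close>
      then have "(d k, p) \<notin> withheld N m d"
        using False k by (auto simp: withheld_def dest: inj_onD)
      then show ?thesis
        using True dk p by (simp add: sent_bits_def)
    next
      case False
      then show ?thesis
        using k p by (simp add: sent_bits_def)
    qed
    then show ?thesis
      by (rule sent)
  qed
qed

lemma coded_placement_scheme:
  assumes "N \<ge> 1" and "N * m \<le> F"
  shows "\<exists>S. (\<forall>k\<in>{1..N}. card (placement S k ` set_pmf (files_pmf N F)) \<le> 2 ^ m) \<and>
    (\<forall>d\<in>demands N N. card (delivery S d ` set_pmf (files_pmf N F)) \<le> 2 ^ (N * F - N * m)) \<and>
    error_probability N N F S = 0"
proof -
  let ?A = "set_pmf (files_pmf N F)"
  \<comment> \<open>A fixed enumeration for each demand vector turns the set of sent bits into a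
    message; distinctness makes its length equal to the number of these bits.\<close>
  have "\<exists>xs. set xs = sent_bits N F m d \<and> distinct xs" for d
    by (rule finite_distinct_list) (rule finite_sent_bits)
  then obtain order where order: "\<And>d. set (order d) = sent_bits N F m d" "\<And>d. distinct (order d)"
    by metis
  define Z where "Z k W = map (bit_parity N W) [(k - 1) * m..<k * m]" for k W
  define X where "X d W = map (\<lambda>(n, p). W n ! p) (order d)" for d and W :: "nat \<Rightarrow> bool list"
  have "W (d k) = W' (d k)"
    if "d \<in> demands N N" "k \<in> {1..N}" "W \<in> ?A" "W' \<in> ?A" "X d W = X d W'" "Z k W = Z k W'"
    for d k W W'
  proof (rule nth_equalityI)
    have dk: "d k \<in> {1..N}"
      using that(1,2) by (auto simp: demands_def PiE_iff)
    show "length (W (d k)) = length (W' (d k))"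
      using dk that(3,4) by (simp add: length_file)
    fix p assume "p < length (W (d k))"
    then have p: "p < F"
      using length_file[OF that(3) dk] by simp
    show "W (d k) ! p = W' (d k) ! p"
    proof (rule bits_decodable[OF that(1,2) p])
      show "W n ! q = W' n ! q" if "(n, q) \<in> sent_bits N F m d" for n q
        using \<open>X d W = X d W'\<close> that by (auto simp: X_def simp flip: order(1))
      show "bit_parity N W q = bit_parity N W' q" if "q \<in> user_block m k" for q
        using \<open>Z k W = Z k W'\<close> that by (auto simp: Z_def user_block_def)
    qed
  qed
  then obtain S where S: "placement S = Z" "delivery S = X" "error_probability N N F S = 0"
    using zero_error_scheme[OF assms(1) assms(1), of F X Z] by blast
  have "card (Z k ` ?A) \<le> 2 ^ m" if "k \<in> {1..N}" for k
    using that card_user_block[of k m]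
    by (intro card_image_bit_strings_le) (simp add: Z_def user_block_def)
  moreover have "card (X d ` ?A) \<le> 2 ^ (N * F - N * m)" if "d \<in> demands N N" for d
  proof -
    have "card (X d ` ?A) \<le> 2 ^ card (sent_bits N F m d)"
      by (intro card_image_bit_strings_le) (simp add: X_def distinct_card[OF order(2)] flip: order(1))
    also have "\<dots> \<le> 2 ^ (N * F - N * m)"
      using card_sent_bits_le[OF that assms(2)] by (intro power_increasing) auto
    finally show ?thesis .
  qed
  ultimately show ?thesis
    using S by (intro exI[of _ S]) auto
qed

section \<open>Rounding and large file sizes\<close>

lemma real_le_powr_if_le_power:
  assumes "c \<le> (2::nat) ^ L" and "real L \<le> x"
  shows "real c \<le> 2 powr x"
proof -
  have "real c \<le> 2 ^ L"
    using assms(1) by (metis of_nat_le_iff of_nat_numeral of_nat_power)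
  also have "\<dots> = 2 powr real L"
    by (simp add: powr_realpow)
  also have "\<dots> \<le> 2 powr x"
    using assms(2) by simp
  finally show ?thesis .
qed

lemma achievable_small_cache:
  fixes M :: real
  assumes "N \<ge> 1" and "0 \<le> M" and "M \<le> 1 / real N"
  shows "achievable N N M (real N * (1 - M))"
  unfolding achievable_def
proof (intro conjI allI impI)
  have NM: "real N * M \<le> 1"
    using assms by (simp add: field_simps)
  have "1 / real N \<le> 1"
    using assms(1) by simp
  then show "0 \<le> real N * (1 - M)"
    using assms(3) by simp
  show "0 \<le> M"
    by (fact assms(2))
  fix \<epsilon> :: real assume \<epsilon>: "\<epsilon> > 0"
  show "\<forall>\<^sub>F F in sequentially. \<exists>S.
      (\<forall>k\<in>{1..N}. real (card (placement S k ` set_pmf (files_pmf N F)))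
        \<le> 2 powr ((M + \<epsilon>) * real F)) \<and>
      (\<forall>d\<in>demands N N. real (card (delivery S d ` set_pmf (files_pmf N F)))
        \<le> 2 powr ((real N * (1 - M) + \<epsilon>) * real F)) \<and>
      error_probability N N F S < \<epsilon>"
    \<comment> \<open>Rounding \<open>M * real F\<close> down shortens each of the \<open>N\<close>
      blocks by at most one bit, so the message grows by at most \<open>N\<close> bits. From this
      threshold on, \<open>\<epsilon> * real F\<close> absorbs them.\<close>
    using eventually_ge_at_top[of "nat \<lceil>real N / \<epsilon>\<rceil>"]
  proof eventually_elim
    case (elim F)
    then have "real N / \<epsilon> \<le> real F"
      by linarith
    then have F: "real N \<le> \<epsilon> * real F"
      using \<epsilon> by (simp add: field_simps)
    define m where "m = nat \<lfloor>M * real F\<rfloor>"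
    have "0 \<le> M * real F"
      using assms(2) by simp
    then have m: "real m \<le> M * real F" "M * real F - 1 \<le> real m"
      unfolding m_def by linarith+
    have "real N * real m \<le> real N * (M * real F)"
      using m(1) by (intro mult_left_mono) auto
    \<comment> \<open>The bound \<open>M \<le> 1 / real N\<close> is what lets \<open>N\<close>
      disjoint blocks fit into a file.\<close>
    also have "\<dots> \<le> real F"
      using mult_right_mono[OF NM, of "real F"] by (simp add: mult.assoc)
    finally have Nm: "N * m \<le> F"
      by (simp flip: of_nat_mult)
    have cache: "real m \<le> (M + \<epsilon>) * real F"
      using m(1) \<epsilon> by (simp add: algebra_simps add_increasing2)
    have "N * m \<le> N * F"
      using assms(1) by (intro le_trans[OF Nm]) simp
    then have "real (N * F - N * m) = real N * real F - real N * real m"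
      by (simp add: of_nat_diff)
    also have "\<dots> \<le> real N * real F - real N * (M * real F - 1)"
      using m(2) by (intro diff_left_mono mult_left_mono) auto
    also have "\<dots> \<le> (real N * (1 - M) + \<epsilon>) * real F"
      using F by (simp add: algebra_simps)
    finally have rate: "real (N * F - N * m) \<le> (real N * (1 - M) + \<epsilon>) * real F" .
    obtain S where
      "\<forall>k\<in>{1..N}. card (placement S k ` set_pmf (files_pmf N F)) \<le> 2 ^ m"
      "\<forall>d\<in>demands N N. card (delivery S d ` set_pmf (files_pmf N F)) \<le> 2 ^ (N * F - N * m)"
      "error_probability N N F S = 0"
      using coded_placement_scheme[OF assms(1) Nm] by blast
    then show ?case
      using real_le_powr_if_le_power[OF _ cache] real_le_powr_if_le_power[OF _ rate] \<epsilon>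
      by (intro exI[of _ S]) auto
  qed
qed

theorem theorem1:
  fixes N :: nat
  assumes "N \<ge> 1"
  shows "achievable N N (1 / real N) (real N - 1) \<and>
    (\<forall>M::real. 0 \<le> M \<and> M \<le> 1 / real N \<longrightarrow> achievable N N M (real N * (1 - M)))"
proof (intro conjI allI impI)
  \<comment> \<open>The first pair is the right endpoint of the range of \<open>M\<close> in the
    second claim.\<close>
  have "real N * (1 - 1 / real N) = real N - 1"
    using assms by (simp add: field_simps)
  then show "achievable N N (1 / real N) (real N - 1)"
    using achievable_small_cache[OF assms, of "1 / real N"] by simp
  show "achievable N N M (real N * (1 - M))" if "0 \<le> M \<and> M \<le> 1 / real N" for M
    using achievable_small_cache[OF assms] that by blast
qed

end
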